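(* Let $n\ge 1$, let $\lambda_1,\dots,\lambda_n$ be real numbers that are linearly independent over the field of rational numbers, let $c_1,\dots,c_n\in\mathbb{C}$, and let $f(x)=\sum_{k=1}^{n}c_k e^{ix\lambda_k}$ for $x\in\mathbb{R}$. Put $r=\inf_{x\in\mathbb{R}}|f(x)|$ and $R=\sup_{x\in\mathbb{R}}|f(x)|$. Then the limit set $\Delta$ of $f$ coincides with the ring $\{z\in\mathbb{C}: r\le |z|\le R\}$.
   Context: Limit sets of a function $f:\mathbb{R}\to\mathbb{C}$: a number $\alpha\in\mathbb{C}$ belongs to $\Delta_{+}$ if there is a real sequence $x_k\to+\infty$ with $\alpha=\lim_{k\to\infty}f(x_k)$; $\alpha$ belongs to $\Delta_{-}$ if there is a real sequence $x_k\to-\infty$ with $\alpha=\lim_{k\to\infty}f(x_k)$. The set of all limit points is $\Delta:=\Delta_{+}\cup\Delta_{-}$. Real numbers $\lambda_1,\dots,\lambda_n$ are linearly independent over the field of rational numbers if $\sum_{k=1}^n r_k\lambda_k=0$ with rational $r_k$ implies that all $r_k=0$. *)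

theory Defs
  imports "HOL-Analysis.Analysis"
begin

definition limit_set_plus :: "(real \<Rightarrow> complex) \<Rightarrow> complex set" where
  "limit_set_plus f =
     {\<alpha>. \<exists>x :: nat \<Rightarrow> real. filterlim x at_top sequentially \<and> (\<lambda>k. f (x k)) \<longlonglongrightarrow> \<alpha>}"

definition limit_set_minus :: "(real \<Rightarrow> complex) \<Rightarrow> complex set" where
  "limit_set_minus f =
     {\<alpha>. \<exists>x :: nat \<Rightarrow> real. filterlim x at_bot sequentially \<and> (\<lambda>k. f (x k)) \<longlonglongrightarrow> \<alpha>}"

definition limit_set :: "(real \<Rightarrow> complex) \<Rightarrow> complex set" where
  "limit_set f = limit_set_plus f \<union> limit_set_minus f"

(* Independence of the family l 1, ..., l n, not of the set of its values: repeated entries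
   make the family dependent, whereas the library's independent speaks about sets. *)
definition rat_lin_independent :: "nat \<Rightarrow> (nat \<Rightarrow> real) \<Rightarrow> bool" where
  "rat_lin_independent n l \<longleftrightarrow>
     (\<forall>q :: nat \<Rightarrow> rat. (\<Sum>k = 1..n. of_rat (q k) * l k) = 0 \<longrightarrow> (\<forall>k \<in> {1..n}. q k = 0))"

end

theory Submission
  imports Defs
begin

text \<open>Only the inclusion of the ring in the limit set needs work. The values of \<open>|f|\<close> form an
  interval with closure \<open>[r, R]\<close>, so every \<open>z\<close> in the ring is close to a rotation of some \<open>f x\<close>.
  Rotating \<open>f x\<close> adds one angle to all the phases \<open>x * l k\<close>, and by Kronecker's theorem any
  phases are approximated by those of \<open>f t\<close>. To have \<open>t\<close> arbitrarily large, add to it a large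
  simultaneous almost-period from Dirichlet's theorem.\<close>

text \<open>Kronecker's theorem gives no control over the size of \<open>t\<close>. A shift that
  moves every \<open>t * \<theta> i\<close> by nearly an integer keeps the approximation, so the
  error \<open>\<epsilon>\<close> is split between the two theorems.\<close>

lemma Kronecker_thm_1_at_top:
  fixes \<alpha> \<theta> :: "nat \<Rightarrow> real" and n :: nat and T :: real
  assumes indp: "module.independent (\<lambda>r. (*) (real_of_int r)) (\<theta> ` {..<n})"
    and inj: "inj_on \<theta> {..<n}" and "\<epsilon> > 0"
  obtains t h where "t \<ge> T" "\<And>i. i < n \<Longrightarrow> \<bar>t * \<theta> i - of_int (h i) - \<alpha> i\<bar> < \<epsilon>"
proof -
  obtain t h where th: "\<And>i. i < n \<Longrightarrow> \<bar>t * \<theta> i - of_int (h i) - \<alpha> i\<bar> < \<epsilon> / 2"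
    using Kronecker_thm_1 [OF indp inj, of "\<epsilon> / 2" \<alpha>] \<open>\<epsilon> > 0\<close> by (metis half_gt_zero)
  obtain N :: nat where N: "N > 0" "1 / real N < \<epsilon> / 2"
    using \<open>\<epsilon> > 0\<close> by (metis half_gt_zero gr0I inverse_eq_divide real_arch_inverse)
  obtain m :: nat where m: "real m > \<bar>T\<bar> + \<bar>t\<bar>"
    using reals_Archimedean2 by blast
  \<comment> \<open>Dirichlet's theorem only guarantees \<open>q \<ge> 1\<close>. Applying it to the
    multiples \<open>real m * \<theta> i\<close> makes the shift \<open>q * m\<close> at least
    \<open>m\<close>, which carries \<open>t\<close> past \<open>T\<close>.\<close>
  obtain q p where q: "0 < q" and qp: "\<And>i. i < n \<Longrightarrow> \<bar>of_int q * (real m * \<theta> i) - of_int (p i)\<bar> < 1 / N"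
    using Dirichlet_approx_simult [OF \<open>N > 0\<close>, of n "\<lambda>i. real m * \<theta> i"] by metis
  have "1 * real m \<le> of_int q * real m"
    using q by (intro mult_right_mono) auto
  show thesis
  proof
    show "T \<le> t + of_int q * real m"
      using m \<open>1 * real m \<le> of_int q * real m\<close> by linarith
    show "\<bar>(t + of_int q * real m) * \<theta> i - of_int (h i + p i) - \<alpha> i\<bar> < \<epsilon>" if "i < n" for i
    proof -
      have "(t + of_int q * real m) * \<theta> i - of_int (h i + p i) - \<alpha> i
          = (t * \<theta> i - of_int (h i) - \<alpha> i) + (of_int q * (real m * \<theta> i) - of_int (p i))"
        by (simp add: algebra_simps)
      then show ?thesis
        using th [OF that] qp [OF that] N by linarith
    qed
  qed
qed

text \<open>A repeated value would give the nontrivial relation \<open>l i - l j = 0\<close>.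
  Injectivity allows the passage from the family to its set of values.\<close>

lemma rat_lin_independent_inj_on:
  assumes "rat_lin_independent n l"
  shows "inj_on l {1..n}"
proof (rule inj_onI, rule ccontr)
  fix i j assume ij: "i \<in> {1..n}" "j \<in> {1..n}" "l i = l j" "i \<noteq> j"
  define q :: "nat \<Rightarrow> rat" where "q k = of_bool (k = i) - of_bool (k = j)" for k
  have "(\<Sum>k = 1..n. of_rat (q k) * l k)
      = (\<Sum>k = 1..n. if k = i then l k else 0) - (\<Sum>k = 1..n. if k = j then l k else 0)"
    unfolding sum_subtractf [symmetric] by (rule sum.cong) (auto simp: q_def of_rat_minus)
  also have "\<dots> = 0"
    using ij by simp
  finally have "q i = 0"
    using assms ij unfolding rat_lin_independent_def by blast
  then show False
    using ij by (simp add: q_def)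
qed

text \<open>This is the form in which Kronecker's theorem takes the hypothesis, with the reals as a
  module over the integers. An integer relation between the values, reindexed along the injective
  \<open>l\<close>, is a rational relation of the family.\<close>

lemma rat_lin_independent_imp_int_independent:
  assumes "rat_lin_independent n l"
  shows "module.independent (\<lambda>r. (*) (real_of_int r)) (l ` {1..n})"
proof -
  interpret Modules.module "\<lambda>r. (*) (real_of_int r)"
    by (simp add: Modules.module.intro distrib_left mult.commute)
  have "u v = 0" if 0: "(\<Sum>v\<in>l ` {1..n}. real_of_int (u v) * v) = 0" and v: "v \<in> l ` {1..n}" for u v
  proof -
    have "(\<Sum>k = 1..n. of_rat (of_int (u (l k))) * l k) = 0"
      using 0 unfolding sum.reindex [OF rat_lin_independent_inj_on [OF assms]] by simp
    then have "\<forall>k\<in>{1..n}. (of_int (u (l k)) :: rat) = 0"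
      using assms unfolding rat_lin_independent_def
      by (elim allE [of _ "\<lambda>k. of_int (u (l k))"]) blast
    then show ?thesis
      using v by auto
  qed
  then show ?thesis
    by (auto simp: dependent_finite)
qed

text \<open>A chord of the unit circle is no longer than its arc: after a rotation one end is 1, and
  the chord has length \<open>2 * \<bar>sin ((a - b) / 2)\<bar>\<close>.\<close>

lemma cmod_exp_ii_diff_le: "cmod (exp (\<i> * of_real a) - exp (\<i> * of_real b)) \<le> \<bar>a - b\<bar>"
proof -
  have "exp (\<i> * of_real a) - exp (\<i> * of_real b)
      = exp (\<i> * of_real b) * (exp (\<i> * of_real (a - b)) - 1)"
    by (simp add: right_diff_distrib flip: exp_add)
  then have "cmod (exp (\<i> * of_real a) - exp (\<i> * of_real b)) = cmod (exp (\<i> * of_real (a - b)) - 1)"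
    by (simp add: norm_mult)
  also have "\<dots> = 2 * \<bar>sin ((a - b) / 2)\<bar>"
    using dist_exp_i_1 [of "a - b"] by simp
  also have "\<dots> \<le> 2 * \<bar>(a - b) / 2\<bar>"
    by (intro mult_left_mono abs_sin_x_le_abs_x) simp
  finally show ?thesis by simp
qed

text \<open>The phases \<open>t * l k\<close> with large \<open>t\<close> come close to every point
  of the torus, and the sum is Lipschitz in its phases, with weights
  \<open>cmod (c k)\<close>.\<close>

lemma exp_sum_approx_at_top:
  fixes l \<phi> :: "nat \<Rightarrow> real" and c :: "nat \<Rightarrow> complex" and T :: real
  assumes indep: "rat_lin_independent n l" and "\<epsilon> > 0"
  obtains t where "t \<ge> T"
    "cmod ((\<Sum>k = 1..n. c k * exp (\<i> * of_real (t * l k))) - (\<Sum>k = 1..n. c k * exp (\<i> * of_real (\<phi> k)))) < \<epsilon>"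
proof -
  \<comment> \<open>The summand 1 keeps \<open>C\<close> positive if all coefficients vanish, and
    makes the final estimate strict.\<close>
  define C where "C = (\<Sum>k = 1..n. cmod (c k)) + 1"
  have "C > 0"
    by (simp add: C_def sum_nonneg add_nonneg_pos)
  define \<delta> where "\<delta> = \<epsilon> / (2 * pi * C)"
  have "\<delta> > 0"
    using \<open>C > 0\<close> \<open>\<epsilon> > 0\<close> by (simp add: \<delta>_def)
  have im: "(\<lambda>i. l (Suc i)) ` {..<n} = l ` {1..n}"
    by (metis image_Suc_lessThan image_image)
  have inj: "inj_on (\<lambda>i. l (Suc i)) {..<n}"
    using comp_inj_on [of Suc "{..<n}" l] rat_lin_independent_inj_on [OF indep]
    by (simp add: image_Suc_lessThan comp_def)
  have ind: "module.independent (\<lambda>r. (*) (real_of_int r)) ((\<lambda>i. l (Suc i)) ` {..<n})"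
    unfolding im by (rule rat_lin_independent_imp_int_independent [OF indep])
  \<comment> \<open>Kronecker's theorem works modulo 1, that is, in full turns. Hence phases and
    \<open>T\<close> are divided by \<open>2 * pi\<close>, and the time finally used is
    \<open>2 * pi * t\<close>.\<close>
  obtain t h where t: "t \<ge> T / (2 * pi)"
    and th: "\<And>i. i < n \<Longrightarrow> \<bar>t * l (Suc i) - of_int (h i) - \<phi> (Suc i) / (2 * pi)\<bar> < \<delta>"
    by (rule Kronecker_thm_1_at_top [OF ind inj \<open>\<delta> > 0\<close>, of "T / (2 * pi)" "\<lambda>i. \<phi> (Suc i) / (2 * pi)"]) (rule that)
  have close: "cmod (exp (\<i> * of_real (2 * pi * t * l k)) - exp (\<i> * of_real (\<phi> k))) \<le> 2 * pi * \<delta>"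
    if k: "k \<in> {1..n}" for k
  proof -
    obtain i where i: "k = Suc i" "i < n"
      using k by (cases k) auto
    \<comment> \<open>Adding \<open>h i\<close> full turns to the target angle leaves its
      exponential unchanged and brings the two angles close as real numbers.\<close>
    have "exp (\<i> * of_real (\<phi> k)) = exp (\<i> * of_real (\<phi> k + of_int (h i) * (2 * pi)))"
      using exp_plus_2pin [of "\<i> * of_real (\<phi> k)" "h i"] by (simp add: algebra_simps)
    then have "cmod (exp (\<i> * of_real (2 * pi * t * l k)) - exp (\<i> * of_real (\<phi> k)))
        \<le> \<bar>2 * pi * t * l k - (\<phi> k + of_int (h i) * (2 * pi))\<bar>"
      using cmod_exp_ii_diff_le by metis
    also have "\<dots> = \<bar>2 * pi * (t * l k - of_int (h i) - \<phi> k / (2 * pi))\<bar>"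
      by (rule arg_cong [of _ _ abs]) (simp add: field_simps)
    also have "\<dots> = 2 * pi * \<bar>t * l k - of_int (h i) - \<phi> k / (2 * pi)\<bar>"
      by (simp add: abs_mult)
    also have "\<dots> \<le> 2 * pi * \<delta>"
      using th [OF i(2)] i(1) by (intro mult_left_mono) auto
    finally show ?thesis .
  qed
  show thesis
  proof
    show "T \<le> 2 * pi * t"
      using t by (simp add: field_simps)
    have "cmod ((\<Sum>k = 1..n. c k * exp (\<i> * of_real (2 * pi * t * l k))) - (\<Sum>k = 1..n. c k * exp (\<i> * of_real (\<phi> k))))
       = cmod (\<Sum>k = 1..n. c k * (exp (\<i> * of_real (2 * pi * t * l k)) - exp (\<i> * of_real (\<phi> k))))"
      by (simp only: sum_subtractf right_diff_distrib)
    also have "\<dots> \<le> (\<Sum>k = 1..n. cmod (c k) * (2 * pi * \<delta>))"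
      by (intro sum_norm_le) (simp only: norm_mult, intro mult_left_mono close, auto)
    also have "\<dots> = (C - 1) * (2 * pi * \<delta>)"
      by (simp add: C_def sum_distrib_right)
    also have "\<dots> < C * (2 * pi * \<delta>)"
      using \<open>\<delta> > 0\<close> by (intro mult_strict_right_mono) auto
    also have "\<dots> = \<epsilon>"
      using \<open>C > 0\<close> by (simp add: \<delta>_def)
    finally show "cmod ((\<Sum>k = 1..n. c k * exp (\<i> * of_real (2 * pi * t * l k))) - (\<Sum>k = 1..n. c k * exp (\<i> * of_real (\<phi> k)))) < \<epsilon>" .
  qed
qed

text \<open>Taking \<open>T = k\<close> and \<open>\<epsilon> = 1 / (k + 1)\<close> for each
  \<open>k\<close> selects the sequence.\<close>

lemma limit_set_plusI:
  assumes "\<And>T \<epsilon>. \<epsilon> > 0 \<Longrightarrow> \<exists>t\<ge>T. cmod (f t - z) < \<epsilon>"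
  shows "z \<in> limit_set_plus f"
proof -
  have "\<exists>t\<ge>real k. cmod (f t - z) < inverse (real (Suc k))" for k
    by (rule assms) simp
  then obtain x where x: "\<And>k. x k \<ge> real k" "\<And>k. cmod (f (x k) - z) < inverse (real (Suc k))"
    by metis
  have "filterlim x at_top sequentially"
    using x(1) by (intro filterlim_at_top_mono [OF filterlim_real_sequentially]) auto
  moreover have "(\<lambda>k. f (x k)) \<longlonglongrightarrow> z"
    by (rule LIM_zero_cancel, rule Lim_null_comparison [OF _ LIMSEQ_inverse_real_of_nat])
      (intro always_eventually allI less_imp_le x(2))
  ultimately show ?thesis
    unfolding limit_set_plus_def by blast
qed

lemma limit_set_subset_closure: "limit_set f \<subseteq> closure (range f)"
proof -
  have "\<alpha> \<in> closure (range f)" if "(\<lambda>k. f (x k)) \<longlonglongrightarrow> \<alpha>" for x :: "nat \<Rightarrow> real" and \<alpha>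
    unfolding closure_sequential using that by (intro exI [of _ "\<lambda>k. f (x k)"]) simp
  then show ?thesis
    unfolding limit_set_def limit_set_plus_def limit_set_minus_def by blast
qed

text \<open>The range is connected, so its closure is an interval. The closure contains the infimum
  and the supremum even where \<open>g\<close> does not attain them.\<close>

lemma closure_range_real:
  fixes g :: "real \<Rightarrow> real"
  assumes "continuous_on UNIV g" "bounded (range g)" "Inf (range g) \<le> y" "y \<le> Sup (range g)"
  shows "y \<in> closure (range g)"
proof -
  have bdd: "bdd_above (range g)" "bdd_below (range g)"
    using assms(2) by (auto simp: bounded_imp_bdd_above bounded_imp_bdd_below)
  have "is_interval (closure (range g))"
    unfolding is_interval_connected_1
    by (intro connected_imp_connected_closure connected_continuous_image assms(1) connected_UNIV)
  moreover have "Inf (range g) \<in> closure (range g)" "Sup (range g) \<in> closure (range g)"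
    using bdd by (auto intro: closure_contains_Inf closure_contains_Sup)
  ultimately show ?thesis
    using assms(3,4) by (meson is_interval_1)
qed

text \<open>Turning \<open>w\<close> onto the ray through \<open>z\<close>, by the angle
  \<open>Arg z - Arg w\<close>, leaves only the difference of the moduli. The polar form also holds
  at 0, so no case is split off.\<close>

lemma rotate_to_dist:
  obtains \<beta> where "cmod (exp (\<i> * of_real \<beta>) * w - z) = \<bar>cmod w - cmod z\<bar>"
proof
  have e: "z = of_real (cmod z) * exp (\<i> * of_real (Arg z))" "w = of_real (cmod w) * exp (\<i> * of_real (Arg w))"
    by (simp_all add: rcis_cmod_Arg flip: cis_conv_exp rcis_def)
  \<comment> \<open>Here \<open>E\<close> stands for the rotation, \<open>W\<close> and
    \<open>Z\<close> for the directions of \<open>w\<close> and \<open>z\<close>, and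
    \<open>b\<close> and \<open>a\<close> for their moduli.\<close>
  have "E * (b * W) - a * Z = Z * (b - a)" if "E * W = Z" for E W Z a b :: complex
    by (simp add: algebra_simps flip: that)
  moreover have "exp (\<i> * of_real (Arg z - Arg w)) * exp (\<i> * of_real (Arg w)) = exp (\<i> * of_real (Arg z))"
    by (simp add: right_diff_distrib flip: exp_add)
  ultimately have "exp (\<i> * of_real (Arg z - Arg w)) * w - z
      = exp (\<i> * of_real (Arg z)) * (of_real (cmod w) - of_real (cmod z))"
    unfolding e [symmetric] by (metis e)
  then show "cmod (exp (\<i> * of_real (Arg z - Arg w)) * w - z) = \<bar>cmod w - cmod z\<bar>"
    by (simp only: norm_mult norm_of_real norm_exp_i_times mult_1 flip: of_real_diff)
qed

theorem corollary2p7: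
  fixes n :: nat and l :: "nat \<Rightarrow> real" and c :: "nat \<Rightarrow> complex"
    and f :: "real \<Rightarrow> complex" and r R :: real
  assumes "n \<ge> 1"
    and "rat_lin_independent n l"
    and "f = (\<lambda>x. \<Sum>k = 1..n. c k * exp (\<i> * of_real (x * l k)))"
    and "r = (INF x. cmod (f x))"
    and "R = (SUP x. cmod (f x))"
  shows "limit_set f = {z :: complex. r \<le> cmod z \<and> cmod z \<le> R}"
proof
  have "cmod (f x) \<le> (\<Sum>k = 1..n. cmod (c k))" for x
    unfolding assms(3) by (intro sum_norm_le) (simp add: norm_mult)
  then have bdd: "bounded (range (\<lambda>x. cmod (f x)))"
    by (auto intro!: boundedI)
  have "continuous_on UNIV (\<lambda>x. cmod (f x))"
    unfolding assms(3) by (intro continuous_intros)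
  note closure = closure_range_real [OF this bdd]
  \<comment> \<open>The ring is closed and contains all values of \<open>f\<close>, hence also their
    limits.\<close>
  have "range f \<subseteq> {z. r \<le> cmod z \<and> cmod z \<le> R}"
    using bdd by (auto simp: assms(4,5) bounded_imp_bdd_above bounded_imp_bdd_below intro: cINF_lower cSUP_upper)
  moreover have "closed {z :: complex. r \<le> cmod z \<and> cmod z \<le> R}"
    by (intro closed_Collect_conj closed_Collect_le continuous_intros)
  ultimately show "limit_set f \<subseteq> {z. r \<le> cmod z \<and> cmod z \<le> R}"
    using limit_set_subset_closure closure_minimal by blast
  show "{z. r \<le> cmod z \<and> cmod z \<le> R} \<subseteq> limit_set f"
  proof safe
    fix z assume z: "r \<le> cmod z" "cmod z \<le> R"
    have "\<exists>t\<ge>T. cmod (f t - z) < \<epsilon>" if "\<epsilon> > 0" for T \<epsilon>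
    proof -
      have cl: "cmod z \<in> closure (range (\<lambda>x. cmod (f x)))"
        using z closure by (simp add: assms(4,5))
      obtain x where x: "\<bar>cmod (f x) - cmod z\<bar> < \<epsilon> / 2"
        using closure_approachableD [OF cl half_gt_zero [OF \<open>\<epsilon> > 0\<close>]] by (auto simp: dist_real_def abs_minus_commute)
      obtain \<beta> where \<beta>: "cmod (exp (\<i> * of_real \<beta>) * f x - z) < \<epsilon> / 2"
        using rotate_to_dist x by metis
      \<comment> \<open>The rotation is absorbed into the phases, so
        \<open>\<beta> + x * l k\<close> can serve as target phases even if no single argument of
        \<open>f\<close> realises them.\<close>
      have rot: "exp (\<i> * of_real \<beta>) * f x = (\<Sum>k = 1..n. c k * exp (\<i> * of_real (\<beta> + x * l k)))"
        by (simp add: assms(3) sum_distrib_left algebra_simps exp_add)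
      obtain t where "t \<ge> T" "cmod (f t - exp (\<i> * of_real \<beta>) * f x) < \<epsilon> / 2"
        using exp_sum_approx_at_top [OF assms(2) half_gt_zero [OF \<open>\<epsilon> > 0\<close>], of T c "\<lambda>k. \<beta> + x * l k"]
        unfolding rot by (auto simp only: assms(3))
      then show ?thesis
        using \<beta> norm_diff_triangle_less by (metis field_sum_of_halves)
    qed
    then have "z \<in> limit_set_plus f"
      by (rule limit_set_plusI)
    then show "z \<in> limit_set f"
      unfolding limit_set_def by blast
  qed
qed

end
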